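(* Let $G$ be a finite strongly connected simple digraph on $n$ vertices. Suppose that its distance matrix $D$ is invertible and satisfies $PDQ=D^T$ for some $n\times n$ permutation matrices $P$ and $Q$. Then $\mu^{\mathrm{out}}=Q\mu^{\mathrm{in}}$.
   Context: A digraph is simple if it has no multiple arcs and no loops (opposite arcs may both be present); it is strongly connected if every vertex is reachable from every other by a directed path; $d(v,w)$ is the length of a shortest directed path from $v$ to $w$; for a fixed ordering $v_1,\dots,v_n$ of the vertices, $D=(d(v_i,v_j))_{1\le i,j\le n}$. $\mathbf 1$ denotes the all-ones column vector in $\mathbb R^n$. Out-curvature $\mu^{\mathrm{out}}$ and in-curvature $\mu^{\mathrm{in}}$ (Steinerberger curvatures of the digraph), viewed as vectors in $\mathbb R^n$: when $D$ is invertible, $\mu^{\mathrm{out}}$ is the unique solution of $DK=n\mathbf 1$ and $\mu^{\mathrm{in}}$ is the unique solution of $D^TK=n\mathbf 1$. *)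

theory Defs
  imports
    "Graph_Theory.Graph_Theory"
    "Jordan_Normal_Form.Matrix"
    "HOL-Combinatorics.Permutations"
begin

(* The value is only meaningful when v is reachable from u; in a strongly connected digraph
   this is the case for all vertices u, v. *)
definition digraph_dist :: "('a, 'b) pre_digraph \<Rightarrow> 'a \<Rightarrow> 'a \<Rightarrow> nat" where
  "digraph_dist G u v = (LEAST k. \<exists>p. pre_digraph.apath G u p v \<and> length p = k)"

(* The list vs is the fixed ordering of the vertices; indices start at 0. *)
definition distance_mat :: "('a, 'b) pre_digraph \<Rightarrow> 'a list \<Rightarrow> real mat" where
  "distance_mat G vs =
     mat (length vs) (length vs) (\<lambda>(i, j). real (digraph_dist G (vs ! i) (vs ! j)))"

definition ones_vec :: "nat \<Rightarrow> real vec" where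
  "ones_vec n = vec n (\<lambda>_. 1)"

(* Both curvatures are only meaningful when the distance matrix is invertible, see
   out_curvature_iff and in_curvature_iff below. *)
definition out_curvature :: "('a, 'b) pre_digraph \<Rightarrow> 'a list \<Rightarrow> real vec" where
  "out_curvature G vs =
     (THE K. K \<in> carrier_vec (length vs) \<and>
        distance_mat G vs *\<^sub>v K = real (length vs) \<cdot>\<^sub>v ones_vec (length vs))"

definition in_curvature :: "('a, 'b) pre_digraph \<Rightarrow> 'a list \<Rightarrow> real vec" where
  "in_curvature G vs =
     (THE K. K \<in> carrier_vec (length vs) \<and>
        transpose_mat (distance_mat G vs) *\<^sub>v K = real (length vs) \<cdot>\<^sub>v ones_vec (length vs))"

definition permutation_mat :: "nat \<Rightarrow> real mat \<Rightarrow> bool" where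
  "permutation_mat n P \<longleftrightarrow>
     (\<exists>\<pi>. \<pi> permutes {..<n} \<and> P = mat n n (\<lambda>(i, j). if j = \<pi> i then 1 else 0))"

lemma distance_mat_carrier: "distance_mat G vs \<in> carrier_mat (length vs) (length vs)"
  by (simp add: distance_mat_def)

lemma ones_vec_carrier: "ones_vec n \<in> carrier_vec n"
  by (simp add: ones_vec_def)

lemma invertible_mat_ex1_solution:
  fixes A :: "real mat"
  assumes A: "A \<in> carrier_mat n n" and inv: "invertible_mat A" and b: "b \<in> carrier_vec n"
  shows "\<exists>!K. K \<in> carrier_vec n \<and> A *\<^sub>v K = b"
proof -
  obtain B where AB: "A * B = 1\<^sub>m n" and BA': "B * A = 1\<^sub>m (dim_row B)"
    using inv A unfolding invertible_mat_def inverts_mat_def by auto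
  have "dim_col B = n" "dim_row B = n"
    using arg_cong[OF AB, of dim_col] arg_cong[OF BA', of dim_col] A by auto
  then have B: "B \<in> carrier_mat n n" and BA: "B * A = 1\<^sub>m n"
    using BA' by auto
  show ?thesis
  proof (rule ex1I[of _ "B *\<^sub>v b"])
    show "B *\<^sub>v b \<in> carrier_vec n \<and> A *\<^sub>v (B *\<^sub>v b) = b"
      using assoc_mult_mat_vec[OF A B b] AB B b by simp
    fix K assume K: "K \<in> carrier_vec n \<and> A *\<^sub>v K = b"
    then show "K = B *\<^sub>v b"
      using assoc_mult_mat_vec[OF B A, of K] BA by simp
  qed
qed

lemma invertible_mat_transpose:
  fixes A :: "real mat"
  assumes A: "A \<in> carrier_mat n n" and inv: "invertible_mat A"
  shows "invertible_mat (transpose_mat A)"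
proof -
  obtain B where AB: "A * B = 1\<^sub>m n" and BA': "B * A = 1\<^sub>m (dim_row B)"
    using inv A unfolding invertible_mat_def inverts_mat_def by auto
  have "dim_col B = n" "dim_row B = n"
    using arg_cong[OF AB, of dim_col] arg_cong[OF BA', of dim_col] A by auto
  then have B: "B \<in> carrier_mat n n" and BA: "B * A = 1\<^sub>m n"
    using BA' by auto
  have "transpose_mat A * transpose_mat B = 1\<^sub>m n" "transpose_mat B * transpose_mat A = 1\<^sub>m n"
    by (simp_all add: AB BA flip: transpose_mult[OF B A] transpose_mult[OF A B])
  then show ?thesis
    using A B unfolding invertible_mat_def inverts_mat_def
    by (intro conjI exI[of _ "transpose_mat B"]) auto
qed

lemma out_curvature_iff:
  assumes "invertible_mat (distance_mat G vs)"
  shows "K = out_curvature G vs \<longleftrightarrow> K \<in> carrier_vec (length vs) \<and>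
    distance_mat G vs *\<^sub>v K = real (length vs) \<cdot>\<^sub>v ones_vec (length vs)"
  using theI'[OF invertible_mat_ex1_solution[OF distance_mat_carrier assms
        smult_carrier_vec[THEN iffD2, OF ones_vec_carrier]]]
    invertible_mat_ex1_solution[OF distance_mat_carrier assms
        smult_carrier_vec[THEN iffD2, OF ones_vec_carrier]]
  unfolding out_curvature_def by blast

lemma in_curvature_iff:
  assumes "invertible_mat (distance_mat G vs)"
  shows "K = in_curvature G vs \<longleftrightarrow> K \<in> carrier_vec (length vs) \<and>
    transpose_mat (distance_mat G vs) *\<^sub>v K = real (length vs) \<cdot>\<^sub>v ones_vec (length vs)"
proof -
  have T: "transpose_mat (distance_mat G vs) \<in> carrier_mat (length vs) (length vs)"
    using distance_mat_carrier by simp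
  note ex1 = invertible_mat_ex1_solution[OF T
      invertible_mat_transpose[OF distance_mat_carrier assms]
      smult_carrier_vec[THEN iffD2, OF ones_vec_carrier]]
  show ?thesis
    using theI'[OF ex1] ex1 unfolding in_curvature_def by blast
qed

end

theory Submission
  imports Defs
begin

text \<open>
  Let \<open>K\<close> be the in-curvature, so \<open>D\<^sup>T K = n \<one>\<close>. Substituting \<open>P D Q\<close> for \<open>D\<^sup>T\<close> gives
  \<open>P (D (Q K)) = n \<one>\<close>. A permutation matrix only rearranges coordinates, so the only vector
  that it sends to a constant vector is that vector itself
  (\<open>permutation_mat_mult_vec_const\<close>). Hence \<open>D (Q K) = n \<one>\<close>, which is the equation that has
  the out-curvature as its unique solution.
\<close>

lemma permutation_mat_carrier: "permutation_mat n P \<Longrightarrow> P \<in> carrier_mat n n"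
  by (auto simp: permutation_mat_def)

lemma permutation_mat_mult_vec_index:
  assumes "\<pi> permutes {..<n}" and x: "x \<in> carrier_vec n" and i: "i < n"
  shows "(mat n n (\<lambda>(i, j). if j = \<pi> i then 1 else 0) *\<^sub>v x) $ i = (x $ \<pi> i :: real)"
proof -
  have "\<pi> i < n"
    using permutes_in_image[OF assms(1), of i] i by simp
  then show ?thesis
    using x i by (simp add: scalar_prod_def if_distrib[of "\<lambda>c. c * _"] cong: if_cong)
qed

text \<open>Every coordinate of \<open>x\<close> occurs among those of \<open>P x\<close>, because the permutation is onto.\<close>

lemma permutation_mat_mult_vec_const:
  fixes c :: real
  assumes P: "permutation_mat n P" and x: "x \<in> carrier_vec n"
    and Px: "P *\<^sub>v x = c \<cdot>\<^sub>v ones_vec n"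
  shows "x = c \<cdot>\<^sub>v ones_vec n"
proof (rule eq_vecI)
  obtain \<pi> where \<pi>: "\<pi> permutes {..<n}"
    and P_eq: "P = mat n n (\<lambda>(i, j). if j = \<pi> i then 1 else 0)"
    using P unfolding permutation_mat_def by blast
  fix j assume "j < dim_vec (c \<cdot>\<^sub>v ones_vec n)"
  then have j: "j < n"
    by (simp add: ones_vec_def)
  then obtain i where i: "i < n" "j = \<pi> i"
    using permutes_image[OF \<pi>] by (metis imageE lessThan_iff)
  have "x $ j = (P *\<^sub>v x) $ i"
    using permutation_mat_mult_vec_index[OF \<pi> x i(1)] i(2) by (simp add: P_eq)
  also have "\<dots> = (c \<cdot>\<^sub>v ones_vec n) $ j"
    using i(1) j by (simp add: Px ones_vec_def)
  finally show "x $ j = (c \<cdot>\<^sub>v ones_vec n) $ j" .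
qed (use x in \<open>simp add: ones_vec_def\<close>)

theorem proposition4p5:
  fixes G :: "('a, 'b) pre_digraph" and vs :: "'a list" and n :: nat and P Q :: "real mat"
  assumes "digraph G" and "strongly_connected G"
    and "card (verts G) = n"
    and "distinct vs" and "set vs = verts G"
    and "invertible_mat (distance_mat G vs)"
    and "permutation_mat n P" and "permutation_mat n Q"
    and "P * distance_mat G vs * Q = transpose_mat (distance_mat G vs)"
  shows "out_curvature G vs = Q *\<^sub>v in_curvature G vs"
proof -
  let ?D = "distance_mat G vs"
  let ?K = "in_curvature G vs"
  have n: "length vs = n"
    using assms(3-5) distinct_card by metis
  have D: "?D \<in> carrier_mat n n"
    using distance_mat_carrier[of G vs] n by simp
  note P = permutation_mat_carrier[OF assms(7)] and Q = permutation_mat_carrier[OF assms(8)]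
  have K: "?K \<in> carrier_vec n" and in_eq: "transpose_mat ?D *\<^sub>v ?K = real n \<cdot>\<^sub>v ones_vec n"
    using in_curvature_iff[OF assms(6), of ?K] n by auto
  have QK: "Q *\<^sub>v ?K \<in> carrier_vec n"
    using Q K by simp
  have "P *\<^sub>v (?D *\<^sub>v (Q *\<^sub>v ?K)) = P * ?D *\<^sub>v (Q *\<^sub>v ?K)"
    by (rule assoc_mult_mat_vec[OF P D QK, symmetric])
  also have "\<dots> = P * ?D * Q *\<^sub>v ?K"
    by (rule assoc_mult_mat_vec[OF mult_carrier_mat[OF P D] Q K, symmetric])
  also have "\<dots> = real n \<cdot>\<^sub>v ones_vec n"
    by (simp only: assms(9) in_eq)
  finally have "?D *\<^sub>v (Q *\<^sub>v ?K) = real n \<cdot>\<^sub>v ones_vec n"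
    by (rule permutation_mat_mult_vec_const[OF assms(7) mult_mat_vec_carrier[OF D QK]])
  then show ?thesis
    using out_curvature_iff[OF assms(6), of "Q *\<^sub>v ?K"] QK n by simp
qed

end
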